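(* Let $\rho\in\mathcal P(\mathbb R^d)$ satisfy $\lim_{r\to0}\mu_\rho(r)<\frac{1}{N(N-1)^2}$, and let $\beta>0$ be such that $$\mu_\rho(\beta)<\frac{1}{N(N-1)^2}.$$ Let $\alpha>0$ satisfy $$\alpha<\phi^{-1}\Big(\frac{N^2(N-1)}{2}\,\phi(\beta)\Big),$$ and let $P\in\Pi(\rho)$ be a minimizer for the transportation cost $C(\rho)$ (or for the truncated transportation cost $C_\alpha(\rho)$). Then $$\operatorname{spt}P\subset\mathbb R^{Nd}\setminus D_\alpha .$$
   Context: $d\ge1$ and $N>1$ are integers; $\mathcal P(X)$ is the set of Borel probability measures on $X$. The function $\phi:(0,+\infty)\to[0,+\infty)$ is continuous, strictly decreasing, and $\lim_{t\to0^+}\phi(t)=+\infty$; by convention $\phi(0)=+\infty$. The cost is $c(x_1,\dots,x_N)=\sum_{1\le i<j\le N}\phi(|x_i-x_j|)$ for $x_1,\dots,x_N\in\mathbb R^d$. For $\alpha>0$ the truncated cost is $c_\alpha(x_1,\dots,x_N)=\sum_{1\le i<j\le N}\min\{\phi(|x_i-x_j|),\phi(\alpha)\}$. $\Pi(\rho)$ is the set of $P\in\mathcal P(\mathbb R^{Nd})$ all of whose $N$ marginals on the factors $\mathbb R^d$ are equal to $\rho$. Set $C(\rho)=\min_{P\in\Pi(\rho)}\int c\,dP$ and $C_\alpha(\rho)=\min_{P\in\Pi(\rho)}\int c_\alpha\,dP$. Measure of concentration: $\mu_\rho(r)=\sup_{x\in\mathbb R^d}\rho(B(x,r))$, with $B(x,r)$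 the open ball. $D_\alpha=\{(x_1,\dots,x_N)\in\mathbb R^{Nd}: |x_i-x_j|<\alpha\text{ for some }i\ne j\}$. $\operatorname{spt}P$ is the support of $P$. *)

theory Defs
  imports "HOL-Probability.Probability"
begin

text \<open>
  A point of $\mathbb{R}^{Nd}$ is written as \<open>x :: (real ^ 'd) ^ 'n\<close>, with $N$ = \<open>CARD('n)\<close>,
  $d$ = \<open>CARD('d)\<close> and \<open>x $ i\<close> the component $x_i$. The index type \<open>'n\<close> carries a linear
  order so that sums over $i < j$ make sense; it is then isomorphic to $\{1, \dots, N\}$.
\<close>

definition borel_probs :: "'a::topological_space measure set" where
  "borel_probs = {M. prob_space M \<and> sets M = sets borel}"

definition phi_ext :: "(real \<Rightarrow> real) \<Rightarrow> real \<Rightarrow> ennreal" where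
  \<comment> \<open>only used for \<open>t \<ge> 0\<close>; incorporates the convention $\phi(0) = +\infty$\<close>
  "phi_ext \<phi> t = (if t = 0 then \<infinity> else ennreal (\<phi> t))"

definition cost :: "(real \<Rightarrow> real) \<Rightarrow> (real ^ 'd) ^ 'n::{finite,linorder} \<Rightarrow> ennreal" where
  "cost \<phi> x = (\<Sum>(i, j) \<in> {(i, j). i < j}. phi_ext \<phi> (norm (x $ i - x $ j)))"

definition trunc_cost ::
    "(real \<Rightarrow> real) \<Rightarrow> real \<Rightarrow> (real ^ 'd) ^ 'n::{finite,linorder} \<Rightarrow> ennreal" where
  "trunc_cost \<phi> \<alpha> x =
     (\<Sum>(i, j) \<in> {(i, j). i < j}. min (phi_ext \<phi> (norm (x $ i - x $ j))) (phi_ext \<phi> \<alpha>))"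

definition plans :: "(real ^ 'd) measure \<Rightarrow> ((real ^ 'd) ^ 'n) measure set" where
  "plans \<rho> = {P \<in> borel_probs. \<forall>i. distr P borel (\<lambda>x. x $ i) = \<rho>}"

definition transport_cost ::
    "((real ^ 'd) ^ 'n \<Rightarrow> ennreal) \<Rightarrow> (real ^ 'd) measure \<Rightarrow> ennreal" where
  "transport_cost c \<rho> = (INF P \<in> plans \<rho>. \<integral>\<^sup>+ x. c x \<partial>P)"

definition is_minimizer ::
    "((real ^ 'd) ^ 'n \<Rightarrow> ennreal) \<Rightarrow> (real ^ 'd) measure \<Rightarrow> ((real ^ 'd) ^ 'n) measure \<Rightarrow> bool" where
  "is_minimizer c \<rho> P \<longleftrightarrow> P \<in> plans \<rho> \<and> (\<integral>\<^sup>+ x. c x \<partial>P) = transport_cost c \<rho>"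

definition concentration :: "(real ^ 'd) measure \<Rightarrow> real \<Rightarrow> real" where
  "concentration \<rho> r = (SUP x. measure \<rho> (ball x r))"

definition near_diagonal :: "real \<Rightarrow> ((real ^ 'd) ^ 'n) set" where
  "near_diagonal \<alpha> = {x. \<exists>i j. i \<noteq> j \<and> norm (x $ i - x $ j) < \<alpha>}"

definition spt :: "'a::topological_space measure \<Rightarrow> 'a set" where
  "spt M = {x. \<forall>U. open U \<longrightarrow> x \<in> U \<longrightarrow> 0 < emeasure M U}"

end

theory Submission
  imports Defs
begin

text \<open>
  Put mass of a plan \<open>P\<close> living on \<open>D\<close> into \<open>x\<^sup>1\<close> and draw \<open>x\<^sup>2, \<dots>, x\<^sup>N\<close> successively from \<open>P\<close>, at
  each stage avoiding the points \<open>y\<close> that have a coordinate within \<open>\<beta>\<close> of a coordinate with a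
  different index of an earlier point. A stage excludes mass at most
  $(N-1) \cdot N(N-1)\mu_\rho(\beta) < 1$, so the law of each \<open>x\<^sup>j\<close> has bounded density with respect to
  \<open>P\<close>, and a small multiple of these \<open>N\<close> laws can be subtracted from \<open>P\<close> and replaced by the laws of
  the points whose \<open>i\<close>-th coordinate is that of \<open>x\<^bsup>k+i\<^esup>\<close>, \<open>k = 1, \<dots>, N\<close>. The marginals do not change
  and the new points have all their coordinates at distance at least \<open>\<beta>\<close>, so together they cost at
  most $\frac{N^2(N-1)}{2}\phi(\beta) < \phi(\alpha)$, whereas each point of $D_\alpha$ costs at least
  $\phi(\alpha)$. Hence a minimizer of finite cost gives no mass to the open set $D_\alpha$.

  Finiteness of the minimal cost comes from the same exchange: applied repeatedly with $D = D_\beta$ it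
  decreases the mass of $D_\beta$ geometrically, and once that mass is small, drawing
  \<open>x\<^sup>2, \<dots>, x\<^sup>N\<close> outside $D_\beta$ allows one to remove all of it at once.
\<close>

section \<open>Finite sums of measures and their integrals\<close>

definition measure_sum :: "'a measure \<Rightarrow> 'i set \<Rightarrow> ('i \<Rightarrow> 'a measure) \<Rightarrow> 'a measure" where
  "measure_sum N I M = measure_of (space N) (sets N) (\<lambda>A. \<Sum>i\<in>I. emeasure (M i) A)"

lemma sets_measure_sum [simp, measurable_cong]: "sets (measure_sum N I M) = sets N"
  and space_measure_sum [simp]: "space (measure_sum N I M) = space N"
  by (simp_all add: measure_sum_def)

lemma emeasure_measure_sum:
  fixes N :: "'a measure"
  assumes sets: "\<And>i. i \<in> I \<Longrightarrow> sets (M i) = sets N" and A: "A \<in> sets N"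
  shows "emeasure (measure_sum N I M) A = (\<Sum>i\<in>I. emeasure (M i) A)"
  unfolding measure_sum_def
proof (rule emeasure_measure_of_sigma)
  show "sigma_algebra (space N) (sets N)" ..
  show "positive (sets N) (\<lambda>A. \<Sum>i\<in>I. emeasure (M i) A)"
    by (simp add: positive_def)
  show "countably_additive (sets N) (\<lambda>A. \<Sum>i\<in>I. emeasure (M i) A)"
  proof (rule countably_additiveI)
    fix A :: "nat \<Rightarrow> 'a set" assume A: "range A \<subseteq> sets N" "disjoint_family A"
    have "(\<Sum>n. \<Sum>i\<in>I. emeasure (M i) (A n)) = (\<Sum>i\<in>I. \<Sum>n. emeasure (M i) (A n))"
      by (rule suminf_sum) auto
    also have "\<dots> = (\<Sum>i\<in>I. emeasure (M i) (\<Union>n. A n))"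
      using A sets by (intro sum.cong refl suminf_emeasure) auto
    finally show "(\<Sum>n. \<Sum>i\<in>I. emeasure (M i) (A n)) = (\<Sum>i\<in>I. emeasure (M i) (\<Union>n. A n))" .
  qed
qed fact

text \<open>Holds for indicators by construction and passes to monotone limits because a finite sum
  commutes with the supremum of increasing sequences.\<close>

lemma nn_integral_measure_sum:
  assumes fin: "finite I" and sets: "\<And>i. i \<in> I \<Longrightarrow> sets (M i) = sets N"
    and f: "f \<in> borel_measurable N"
  shows "(\<integral>\<^sup>+x. f x \<partial>measure_sum N I M) = (\<Sum>i\<in>I. \<integral>\<^sup>+x. f x \<partial>M i)"
  using f
proof (induction rule: borel_measurable_induct)
  case (cong f g)
  have "integral\<^sup>N (M i) f = integral\<^sup>N (M i) g" if "i \<in> I" for i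
    using cong(3) sets_eq_imp_space_eq[OF sets[OF that]] by (intro nn_integral_cong) auto
  moreover have "integral\<^sup>N (measure_sum N I M) f = integral\<^sup>N (measure_sum N I M) g"
    using cong(3) by (intro nn_integral_cong) auto
  ultimately show ?case using cong(4) by simp
next
  case (set A)
  then show ?case by (simp add: emeasure_measure_sum sets)
next
  case (mult u v)
  have "u \<in> borel_measurable (M i)" if "i \<in> I" for i
    using mult(2) sets[OF that] by (simp cong: measurable_cong_sets)
  with mult show ?case
    by (simp add: nn_integral_cmult sum_distrib_left cong: sum.cong)
next
  case (add u v)
  have "u \<in> borel_measurable (M i)" "v \<in> borel_measurable (M i)" if "i \<in> I" for i
    using add sets[OF that] by (simp_all cong: measurable_cong_sets)
  with add show ?case
    by (simp add: nn_integral_add sum.distrib cong: sum.cong)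
next
  case (seq U)
  have U: "U n \<in> borel_measurable (M i)" if "i \<in> I" for i n
    using seq(1) sets[OF that] by (simp cong: measurable_cong_sets)
  have "(\<integral>\<^sup>+x. (SUP n. U n) x \<partial>measure_sum N I M) = (SUP n. \<integral>\<^sup>+x. U n x \<partial>measure_sum N I M)"
    unfolding SUP_apply using seq by (intro nn_integral_monotone_convergence_SUP) auto
  also have "\<dots> = (SUP n. \<Sum>i\<in>I. \<integral>\<^sup>+x. U n x \<partial>M i)"
    using seq by simp
  also have "\<dots> = (\<Sum>i\<in>I. SUP n. \<integral>\<^sup>+x. U n x \<partial>M i)"
    using seq(3) by (intro ennreal_SUP_sum) (auto simp: incseq_def le_fun_def intro!: nn_integral_mono)
  also have "\<dots> = (\<Sum>i\<in>I. \<integral>\<^sup>+x. (SUP n. U n) x \<partial>M i)"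
    unfolding SUP_apply using seq U
    by (intro sum.cong refl nn_integral_monotone_convergence_SUP[symmetric]) auto
  finally show ?case .
qed

section \<open>Successive choice of mutually separated points\<close>

text \<open>\<open>x\<close> stands for the point taken from the set to be emptied, \<open>Y\<close>
  for the points drawn to accompany it.\<close>

definition separated :: "('a \<Rightarrow> 'a \<Rightarrow> bool) \<Rightarrow> 'a set \<Rightarrow> 'i set \<Rightarrow> 'a \<Rightarrow> ('i \<Rightarrow> 'a) \<Rightarrow> bool" where
  "separated R A I x Y \<longleftrightarrow>
     (\<forall>j\<in>I. Y j \<in> A \<and> \<not> R x (Y j)) \<and> (\<forall>j\<in>I. \<forall>l\<in>I. j \<noteq> l \<longrightarrow> \<not> R (Y j) (Y l))"

lemma pred_compose2:
  assumes "Measurable.pred (M \<Otimes>\<^sub>M M) (\<lambda>(x, y). R x y)" "f \<in> N \<rightarrow>\<^sub>M M" "g \<in> N \<rightarrow>\<^sub>M M"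
  shows "Measurable.pred N (\<lambda>z. R (f z) (g z))"
  using measurable_compose[OF measurable_Pair[OF assms(2,3)] assms(1)] by simp

lemma pred_separated:
  assumes R: "Measurable.pred (M \<Otimes>\<^sub>M M) (\<lambda>(x, y). R x y)"
    and A: "A \<in> sets M" and I: "finite I"
    and f: "f \<in> N \<rightarrow>\<^sub>M M" and g: "\<And>j. j \<in> I \<Longrightarrow> (\<lambda>z. g z j) \<in> N \<rightarrow>\<^sub>M M"
  shows "Measurable.pred N (\<lambda>z. separated R A I (f z) (g z))"
proof -
  note [measurable] = A f g pred_compose2[OF R]
  show ?thesis
    unfolding separated_def using I by measurable
qed

text \<open>
  A union bound over all pairs would lose a factor \<open>N/2\<close>; the entries have to be chosen one after the other.
\<close>
lemma emeasure_separated_ge: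
  fixes \<kappa> q :: real
  assumes M: "prob_space M"
    and R: "Measurable.pred (M \<Otimes>\<^sub>M M) (\<lambda>(x, y). R x y)"
    and sym: "\<And>x y. R x y \<Longrightarrow> R y x"
    and bound: "\<And>x. x \<in> space M \<Longrightarrow> measure M {y \<in> space M. R x y} \<le> q"
    and A: "A \<in> sets M" and x: "x \<in> space M"
    and I: "finite I" and \<kappa>: "0 \<le> \<kappa>" "\<kappa> + card I * q \<le> measure M A"
  shows "ennreal (\<kappa> ^ card I) \<le>
    emeasure (\<Pi>\<^sub>M i\<in>I. M) {Y \<in> space (\<Pi>\<^sub>M i\<in>I. M). separated R A I x Y}"
  using I \<kappa>(2)
proof (induction I rule: finite_induct)
  case empty
  then show ?case
    by (simp add: separated_def space_PiM PiM_empty)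
next
  case (insert k I)
  interpret M: prob_space M by fact
  interpret product_sigma_finite "\<lambda>_. M" by standard
  let ?T = "\<lambda>I. {Y \<in> space (\<Pi>\<^sub>M i\<in>I. M). separated R A I x Y}"
  have q: "0 \<le> q" using bound[OF x] measure_nonneg order_trans by blast
  note [measurable] = A
  have T [measurable]: "?T I \<in> sets (\<Pi>\<^sub>M i\<in>I. M)" if "finite I" for I
    using R A that x by (intro predE pred_separated) auto
  have bad: "{y \<in> space M. R z y} \<in> sets M" if "z \<in> space M" for z
    using that by (intro predE pred_compose2[OF R]) auto
  have "ennreal (\<kappa> ^ card (insert k I)) = ennreal \<kappa> * ennreal (\<kappa> ^ card I)"
    using insert.hyps \<kappa>(1) by (simp add: ennreal_mult)
  \<comment> \<open>The induction hypothesis is available with the same \<open>\<kappa>\<close>: one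
    index less frees the mass \<open>q\<close>, which is nonnegative.\<close>
  also have "\<dots> \<le> ennreal \<kappa> * emeasure (\<Pi>\<^sub>M i\<in>I. M) (?T I)"
    using insert.prems insert.hyps q by (intro mult_left_mono insert.IH) (auto simp: algebra_simps)
  also have "\<dots> = (\<integral>\<^sup>+Y. ennreal \<kappa> * indicator (?T I) Y \<partial>(\<Pi>\<^sub>M i\<in>I. M))"
    using insert.hyps by (intro nn_integral_cmult_indicator[symmetric] T)
  \<comment> \<open>By Fubini it is enough that over each separated \<open>Y\<close> the values
    allowed for entry \<open>k\<close> have mass at least \<open>\<kappa>\<close>.\<close>
  also have "\<dots> \<le> (\<integral>\<^sup>+Y. (\<integral>\<^sup>+y. indicator (?T (insert k I)) (Y(k := y)) \<partial>M) \<partial>(\<Pi>\<^sub>M i\<in>I. M))"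
  proof (rule nn_integral_mono)
    fix Y assume Y: "Y \<in> space (\<Pi>\<^sub>M i\<in>I. M)"
    show "ennreal \<kappa> * indicator (?T I) Y \<le> (\<integral>\<^sup>+y. indicator (?T (insert k I)) (Y(k := y)) \<partial>M)"
    proof (cases "Y \<in> ?T I")
      case True
      \<comment> \<open>The points already present, each of which forbids mass at most
        \<open>q\<close>; there are at most \<open>card I + 1\<close> of them, fewer if some
        coincide.\<close>
      define Z where "Z = insert x (Y ` I)"
      define G where "G = A - (\<Union>z\<in>Z. {y \<in> space M. R z y})"
      have Z: "finite Z" "Z \<subseteq> space M" "card Z \<le> Suc (card I)"
        using insert.hyps x Y card_image_le[of I Y]
        by (auto simp: Z_def space_PiM PiE_def card_insert_if)
      have U: "(\<Union>z\<in>Z. {y \<in> space M. R z y}) \<in> sets M"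
        using Z bad by (intro sets.finite_UN) auto
      have "measure M (\<Union>z\<in>Z. {y \<in> space M. R z y}) \<le> (\<Sum>z\<in>Z. measure M {y \<in> space M. R z y})"
        using Z bad by (intro M.finite_measure_subadditive_finite) auto
      also have "\<dots> \<le> (\<Sum>z\<in>Z. q)"
        using Z bound by (intro sum_mono) auto
      also have "\<dots> \<le> Suc (card I) * q"
        using Z q by (simp add: mult_right_mono del: of_nat_Suc)
      finally have "measure M A - Suc (card I) * q \<le> measure M A - measure M (\<Union>z\<in>Z. {y \<in> space M. R z y})"
        by simp
      also have "\<dots> \<le> measure M G"
        unfolding G_def using U M.finite_measure_Diff'[OF A U]
          M.finite_measure_mono[of "A \<inter> (\<Union>z\<in>Z. {y \<in> space M. R z y})" "\<Union>z\<in>Z. {y \<in> space M. R z y}"]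
        by (simp add: inf.coboundedI2)
      finally have "\<kappa> \<le> measure M G" using insert.prems insert.hyps by simp
      then have "ennreal \<kappa> \<le> emeasure M G"
        by (simp add: M.emeasure_eq_measure ennreal_leI)
      also have "\<dots> = (\<integral>\<^sup>+y. indicator G y \<partial>M)" using U by (simp add: G_def)
      also have "\<dots> \<le> (\<integral>\<^sup>+y. indicator (?T (insert k I)) (Y(k := y)) \<partial>M)"
      proof (rule nn_integral_mono)
        fix y assume y: "y \<in> space M"
        have "Y(k := y) \<in> ?T (insert k I)" if G: "y \<in> G"
        proof -
          have "\<not> R x y" "\<And>j. j \<in> I \<Longrightarrow> \<not> R (Y j) y" "y \<in> A"
            using G y by (auto simp: G_def Z_def)
          \<comment> \<open>\<open>separated\<close> asks for both orders of a pair, hence the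
            symmetry of \<open>R\<close>.\<close>
          moreover have "\<not> R y (Y j)" if "j \<in> I" for j
            using calculation(2)[OF that] sym by blast
          moreover have "Y(k := y) \<in> space (\<Pi>\<^sub>M i\<in>insert k I. M)"
            using Y y by (auto simp: space_PiM PiE_def extensional_def)
          ultimately show ?thesis
            using True insert.hyps by (auto simp: separated_def)
        qed
        then show "(indicator G y :: ennreal) \<le> indicator (?T (insert k I)) (Y(k := y))"
          by (auto simp: indicator_def)
      qed
      finally show ?thesis using True by simp
    qed simp
  qed
  also have "\<dots> = (\<integral>\<^sup>+Y. indicator (?T (insert k I)) Y \<partial>(\<Pi>\<^sub>M i\<in>insert k I. M))"
    using insert.hyps by (intro product_nn_integral_insert[symmetric]) auto
  also have "\<dots> = emeasure (\<Pi>\<^sub>M i\<in>insert k I. M) (?T (insert k I))"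
    using insert.hyps by (intro nn_integral_indicator T) auto
  finally show ?case .
qed

section \<open>Regrouping coordinates without changing the marginals\<close>

lemma measurable_vec_nth [measurable]:
  "(\<lambda>x :: 'a::euclidean_space ^ 'n. x $ i) \<in> borel_measurable borel"
  by (intro borel_measurable_continuous_onI continuous_intros)

lemma measurable_vec_lambda:
  fixes f :: "'b \<Rightarrow> 'n::finite \<Rightarrow> 'a::euclidean_space"
  assumes "\<And>i. (\<lambda>x. f x i) \<in> borel_measurable M"
  shows "(\<lambda>x. \<chi> i. f x i) \<in> borel_measurable M"
proof (subst borel_measurable_euclidean_space, intro ballI)
  fix b :: "'a ^ 'n" assume "b \<in> Basis"
  have "(\<lambda>x. \<Sum>i\<in>UNIV. f x i \<bullet> (b $ i)) \<in> borel_measurable M"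
    using assms by (intro borel_measurable_sum borel_measurable_inner) auto
  then show "(\<lambda>x. (\<chi> i. f x i) \<bullet> b) \<in> borel_measurable M"
    by (simp add: inner_vec_def)
qed

text \<open>For fixed \<open>i\<close> the map sending \<open>k\<close> to \<open>\<tau> k i\<close>
  permutes the points, so the regrouped points have the same total law of \<open>i\<close>-th
  coordinates as the removed ones. The identity has sums on both sides, so that it also holds for
  infinite integrals, and one \<open>P'\<close> serves all \<open>c\<close>.\<close>

lemma swap_coordinates:
  fixes P :: "((real ^ 'd) ^ 'n) measure"
    and X :: "'n \<Rightarrow> 'e \<Rightarrow> (real ^ 'd) ^ 'n" and \<tau> :: "'n \<Rightarrow> 'n \<Rightarrow> 'n"
  assumes P: "P \<in> plans \<rho>"
    and X [measurable]: "\<And>j. X j \<in> borel_measurable J"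
    and le: "\<And>A. A \<in> sets borel \<Longrightarrow> (\<Sum>j\<in>UNIV. emeasure J (X j -` A \<inter> space J)) \<le> emeasure P A"
    and \<tau>: "\<And>i. bij (\<lambda>k. \<tau> k i)"
  shows "\<exists>P'\<in>plans \<rho>. \<forall>c\<in>borel_measurable borel.
      (\<integral>\<^sup>+x. c x \<partial>P') + (\<Sum>j\<in>UNIV. \<integral>\<^sup>+e. c (X j e) \<partial>J) =
      (\<integral>\<^sup>+x. c x \<partial>P) + (\<Sum>k\<in>UNIV. \<integral>\<^sup>+e. c (\<chi> i. X (\<tau> k i) e $ i) \<partial>J)"
proof (intro bexI ballI)
  define Y where "Y k e = (\<chi> i. X (\<tau> k i) e $ i)" for k e
  define M1 where "M1 = measure_sum borel UNIV (\<lambda>j. distr J borel (X j))"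
  define M2 where "M2 = measure_sum borel UNIV (\<lambda>k. distr J borel (Y k))"
  define P' where "P' = measure_sum borel UNIV (\<lambda>b. if b then diff_measure P M1 else M2)"
  interpret P: prob_space P using P by (simp add: plans_def borel_probs_def)
  have sP [measurable_cong, simp]: "sets P = sets borel"
    using P by (simp add: plans_def borel_probs_def)
  have marg: "distr P borel (\<lambda>x. x $ i) = \<rho>" for i
    using P by (simp add: plans_def)
  have Y [measurable]: "Y k \<in> borel_measurable J" for k
    unfolding Y_def[abs_def] by (intro measurable_vec_lambda measurable_compose[OF X measurable_vec_nth])
  have sM [simp]: "sets M1 = sets borel" "sets M2 = sets borel" "sets P' = sets borel"
    by (simp_all add: M1_def M2_def P'_def)
  have e1: "emeasure M1 A = (\<Sum>j\<in>UNIV. emeasure J (X j -` A \<inter> space J))" if "A \<in> sets borel" for A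
    using that by (simp add: M1_def emeasure_measure_sum emeasure_distr)
  have M1_le: "emeasure M1 A \<le> emeasure P A" if "A \<in> sets borel" for A
    using le[OF that] e1[OF that] by simp
  have M1_fin: "finite_measure M1"
    using M1_le[of UNIV] P.emeasure_finite[of UNIV] sets_eq_imp_space_eq[OF sM(1)]
    by (intro finite_measureI) (auto simp: top_unique)
  \<comment> \<open>Hypothesis \<open>le\<close> makes \<open>diff_measure P M1\<close> a true
    difference, so the subtraction can be handled as a sum.\<close>
  have "P = measure_sum borel UNIV (\<lambda>b. if b then diff_measure P M1 else M1)"
  proof (rule measure_eqI)
    fix A assume "A \<in> sets P"
    then have A: "A \<in> sets borel" by simp
    show "emeasure P A = emeasure (measure_sum borel UNIV (\<lambda>b. if b then diff_measure P M1 else M1)) A"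
      using A emeasure_diff_measure[OF P.finite_measure_axioms M1_fin, of A] M1_le
      by (subst emeasure_measure_sum) (auto simp: UNIV_bool add_diff_inverse_ennreal)
  qed simp
  then have intP: "(\<integral>\<^sup>+x. c x \<partial>P) = (\<integral>\<^sup>+x. c x \<partial>diff_measure P M1) + (\<integral>\<^sup>+x. c x \<partial>M1)"
    if "c \<in> borel_measurable borel" for c
    using that nn_integral_measure_sum[of UNIV "\<lambda>b. if b then diff_measure P M1 else M1" borel c]
    by (auto simp: UNIV_bool add.commute)
  have intP': "(\<integral>\<^sup>+x. c x \<partial>P') = (\<integral>\<^sup>+x. c x \<partial>diff_measure P M1) + (\<integral>\<^sup>+x. c x \<partial>M2)"
    if "c \<in> borel_measurable borel" for c
    unfolding P'_def using that by (subst nn_integral_measure_sum) (auto simp: UNIV_bool add.commute)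
  have balance: "(\<integral>\<^sup>+x. c x \<partial>P') + (\<integral>\<^sup>+x. c x \<partial>M1) = (\<integral>\<^sup>+x. c x \<partial>P) + (\<integral>\<^sup>+x. c x \<partial>M2)"
    if "c \<in> borel_measurable borel" for c
    by (simp add: intP intP' that ac_simps)
  show "(\<integral>\<^sup>+x. c x \<partial>P') + (\<Sum>j\<in>UNIV. \<integral>\<^sup>+e. c (X j e) \<partial>J) =
      (\<integral>\<^sup>+x. c x \<partial>P) + (\<Sum>k\<in>UNIV. \<integral>\<^sup>+e. c (\<chi> i. X (\<tau> k i) e $ i) \<partial>J)"
    if c [measurable]: "c \<in> borel_measurable borel" for c
    using balance[OF c] unfolding Y_def[symmetric]
    by (simp add: M1_def M2_def nn_integral_measure_sum nn_integral_distr)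
  have "distr P' borel (\<lambda>x. x $ i) = \<rho>" for i
  proof (rule measure_eqI)
    show "sets (distr P' borel (\<lambda>x. x $ i)) = sets \<rho>"
      using marg[of i] by auto
    fix B assume "B \<in> sets (distr P' borel (\<lambda>x. x $ i))"
    then have B [measurable]: "B \<in> sets borel" by simp
    define A where "A = {x :: (real ^ 'd) ^ 'n. x $ i \<in> B}"
    have A: "A \<in> sets borel"
      unfolding A_def by measurable
    have "emeasure M2 A = (\<Sum>k\<in>UNIV. emeasure J (Y k -` A \<inter> space J))"
      using A by (simp add: M2_def emeasure_measure_sum emeasure_distr)
    also have "\<dots> = (\<Sum>k\<in>UNIV. emeasure J (X (\<tau> k i) -` A \<inter> space J))"
      by (intro sum.cong refl arg_cong2[where f = emeasure]) (auto simp: A_def Y_def)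
    also have "\<dots> = emeasure M1 A"
      unfolding e1[OF A] using \<tau> by (rule sum.reindex_bij_betw)
    \<comment> \<open>The balance for the indicator of the cylinder \<open>A\<close>; the finite
      mass of \<open>M1\<close> can then be cancelled.\<close>
    finally have "emeasure P' A + emeasure M1 A = emeasure P A + emeasure M1 A"
      using balance[of "indicator A"] A by simp
    then have "emeasure P' A = emeasure P A"
      using finite_measure.emeasure_finite[OF M1_fin, of A] by simp
    moreover have "emeasure (distr Q borel (\<lambda>x. x $ i)) B = emeasure Q A" if "sets Q = sets borel" for Q
      using that sets_eq_imp_space_eq[OF that]
      by (subst emeasure_distr) (auto simp: A_def vimage_def cong: measurable_cong_sets)
    ultimately show "emeasure (distr P' borel (\<lambda>x. x $ i)) B = emeasure \<rho> B"
      using marg[of i] by (metis sM(3) sP)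
  qed
  \<comment> \<open>\<open>P'\<close> has total mass 1 because its marginals do.\<close>
  moreover from this have "prob_space P'"
  proof -
    have "prob_space (distr P borel (\<lambda>x. x $ i))" for i
      by (intro P.prob_space_distr) measurable
    then have "prob_space (distr P' borel (\<lambda>x. x $ i))" for i
      using calculation marg by simp
    then show ?thesis
      by (rule prob_space_distrD[rotated]) (simp cong: measurable_cong_sets)
  qed
  ultimately show "P' \<in> plans \<rho>"
    by (simp add: plans_def borel_probs_def)
qed

section \<open>Latin squares\<close>

lemma mod_add_left_cancel:
  fixes a b m n :: nat
  assumes "(m + a) mod n = (m + b) mod n" "a < n" "b < n"
  shows "a = b"
proof -
  have le: "a = b" if "(m + a) mod n = (m + b) mod n" "a \<le> b" "b < n" for a b
  proof -
    have "n dvd (m + b) - (m + a)"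
      using that by (subst mod_eq_dvd_iff_nat[symmetric]) auto
    then have "n dvd b - a" by simp
    moreover have "b - a < n" using that by simp
    ultimately have "b - a = 0" using nat_dvd_not_less by blast
    with that show "a = b" by simp
  qed
  show ?thesis
    using le[of a b] le[of b a] assms by (cases "a \<le> b") auto
qed

text \<open>The addition table of the integers modulo \<open>CARD('n)\<close>, carried over by an
  enumeration of the index type. Injective rows let a new point take its coordinates from pairwise
  different points; bijective columns preserve the marginals.\<close>

lemma latin_square_exists:
  "\<exists>\<tau> :: 'n::finite \<Rightarrow> 'n \<Rightarrow> 'n. (\<forall>k. inj (\<tau> k)) \<and> (\<forall>i. bij (\<lambda>k. \<tau> k i))"
proof -
  let ?N = "CARD('n)"
  obtain h :: "'n \<Rightarrow> nat" where h: "bij_betw h UNIV {0..<?N}"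
    using ex_bij_betw_finite_nat[OF finite[of UNIV]] by blast
  let ?g = "inv_into UNIV h"
  define \<tau> where "\<tau> k i = ?g ((h k + h i) mod ?N)" for k i
  have lt: "h k < ?N" for k using h by (auto simp: bij_betw_def)
  have inj_h: "a = b" if "h a = h b" for a b
    using h that by (auto simp: bij_betw_def inj_def)
  have h\<tau>: "h (\<tau> k i) = (h k + h i) mod ?N" for k i
    unfolding \<tau>_def by (rule bij_betw_inv_into_right[OF h]) simp
  have "i = j" if "\<tau> k i = \<tau> k j" for i j k
    using mod_add_left_cancel[of "h k" "h i" ?N "h j"] lt h\<tau>[of k i] h\<tau>[of k j] that by (simp add: inj_h)
  then have inj1: "inj (\<tau> k)" for k by (rule injI)
  \<comment> \<open>The table is symmetric, so the columns inherit injectivity from the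
    rows.\<close>
  have "(\<lambda>k. \<tau> k i) = \<tau> i" for i by (simp add: fun_eq_iff \<tau>_def add.commute)
  with inj1 have "inj (\<lambda>k. \<tau> k i)" for i by simp
  then have "bij (\<lambda>k. \<tau> k i)" for i
    by (simp add: bij_def finite_UNIV_inj_surj)
  with inj1 show ?thesis by blast
qed

section \<open>Closeness of two points and its probability under a plan\<close>

text \<open>Equal indices are left out because regrouping keeps every coordinate in its place
  \<open>i\<close>, so two \<open>i\<close>-th coordinates never meet in one point.\<close>

definition cross_close :: "real \<Rightarrow> ('a::real_normed_vector) ^ 'n \<Rightarrow> 'a ^ 'n \<Rightarrow> bool" where
  "cross_close \<beta> x y \<longleftrightarrow> (\<exists>i j. i \<noteq> j \<and> norm (x $ i - y $ j) < \<beta>)"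

lemma cross_close_sym: "cross_close \<beta> x y \<Longrightarrow> cross_close \<beta> y x"
  unfolding cross_close_def by (metis norm_minus_commute)

lemma pred_cross_close:
  "Measurable.pred (borel \<Otimes>\<^sub>M borel) (\<lambda>(x :: 'a::euclidean_space ^ 'n, y). cross_close \<beta> x y)"
proof -
  have "(\<lambda>(x, y). cross_close \<beta> x y) =
      (\<lambda>z :: ('a ^ 'n) \<times> ('a ^ 'n). \<exists>i\<in>UNIV. \<exists>j\<in>UNIV. i \<noteq> j \<and> norm (fst z $ i - snd z $ j) < \<beta>)"
    by (simp add: cross_close_def fun_eq_iff split_beta)
  also have "Measurable.pred (borel \<Otimes>\<^sub>M borel) \<dots>"
    by measurable
  finally show ?thesis .
qed

text \<open>Openness gives measurability and, at the end, turns vanishing mass into disjointness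
  from the support.\<close>

lemma open_near_diagonal: "open (near_diagonal \<alpha> :: ((real ^ 'd) ^ 'n) set)"
proof -
  have "near_diagonal \<alpha> =
      (\<Union>i. \<Union>j. {x :: (real ^ 'd) ^ 'n. i \<noteq> j \<and> norm (x $ i - x $ j) < \<alpha>})"
    by (auto simp: near_diagonal_def)
  then show ?thesis
    by (auto intro!: open_UN open_Collect_conj open_Collect_less continuous_intros)
qed

lemma near_diagonal_borel [measurable]: "near_diagonal \<alpha> \<in> sets borel"
  by (intro borel_open open_near_diagonal)

lemma sets_plan: "P \<in> plans \<rho> \<Longrightarrow> sets P = sets borel"
  and prob_space_plan: "P \<in> plans \<rho> \<Longrightarrow> prob_space P"
  and distr_plan: "P \<in> plans \<rho> \<Longrightarrow> distr P borel (\<lambda>x. x $ i) = \<rho>"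
  by (simp_all add: plans_def borel_probs_def)

lemma measure_ball_le_concentration:
  assumes "prob_space \<rho>"
  shows "measure \<rho> (ball x r) \<le> concentration \<rho> r"
  unfolding concentration_def
  using prob_space.prob_le_1[OF assms] by (intro cSUP_upper) (auto intro!: bdd_aboveI)

lemma card_off_diagonal: "card {(i :: 'n::finite, j :: 'n). i \<noteq> j} = CARD('n) * (CARD('n) - 1)"
proof -
  have "{(i :: 'n, j :: 'n). i \<noteq> j} = (SIGMA i : UNIV. - {i})" by auto
  then show ?thesis by (simp add: card_Diff_singleton Compl_eq_Diff_UNIV)
qed

text \<open>A union bound over the \<open>N(N-1)\<close> ordered pairs of distinct indices: each
  pair confines one coordinate of \<open>y\<close> to a ball of radius \<open>\<beta>\<close>, and
  the mass of that event is read off a marginal.\<close>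

lemma measure_cross_close_le:
  fixes P :: "((real ^ 'd) ^ 'n) measure"
  assumes P: "P \<in> plans \<rho>"
  shows "measure P {y. cross_close \<beta> x y} \<le>
    real CARD('n) * (real CARD('n) - 1) * concentration \<rho> \<beta>"
proof -
  interpret P: prob_space P using P by (rule prob_space_plan)
  have [measurable_cong, simp]: "sets P = sets borel" using P by (rule sets_plan)
  \<comment> \<open>Any index will do: \<open>\<rho>\<close> is a probability measure because it is
    a marginal of \<open>P\<close>.\<close>
  have "prob_space (distr P borel (\<lambda>x. x $ undefined))"
    by (intro P.prob_space_distr) measurable
  then have \<rho>: "prob_space \<rho>" by (simp add: distr_plan[OF P])
  let ?K = "{(i :: 'n, j :: 'n). i \<noteq> j}"
  let ?B = "\<lambda>(i, j). {y :: (real ^ 'd) ^ 'n. y $ j \<in> ball (x $ i) \<beta>}"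
  have B: "?B p \<in> sets P" for p
    by (cases p) (simp, measurable)
  have "{y. cross_close \<beta> x y} = (\<Union>p\<in>?K. ?B p)"
    by (auto simp: cross_close_def dist_norm)
  then have "measure P {y. cross_close \<beta> x y} \<le> (\<Sum>p\<in>?K. measure P (?B p))"
    using B by (auto intro!: P.finite_measure_subadditive_finite)
  also have "\<dots> \<le> (\<Sum>p\<in>?K. concentration \<rho> \<beta>)"
  proof (rule sum_mono)
    fix p :: "'n \<times> 'n"
    obtain i j where p: "p = (i, j)" by fastforce
    have "measure P (?B p) = measure (distr P borel (\<lambda>y. y $ j)) (ball (x $ i) \<beta>)"
      using sets_eq_imp_space_eq[OF sets_plan[OF P]]
      by (subst measure_distr) (auto simp: p vimage_def)
    then show "measure P (?B p) \<le> concentration \<rho> \<beta>"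
      using measure_ball_le_concentration[OF \<rho>] by (simp add: distr_plan[OF P])
  qed
  also have "\<dots> = real CARD('n) * (real CARD('n) - 1) * concentration \<rho> \<beta>"
    using zero_less_card_finite[where 'a = 'n] by (simp add: card_off_diagonal of_nat_diff Suc_leI)
  finally show ?thesis .
qed

section \<open>Exchanging part of a plan for points off the diagonal strip\<close>

lemma ennreal_inverse_antimono:
  fixes a b :: ennreal
  shows "a \<le> b \<Longrightarrow> inverse b \<le> inverse a"
  including ennreal.lifting by transfer (rule ereal_inverse_antimono)

text \<open>
  The effect on integrals of exchanging the part \<open>s P|\<^sub>D\<close> of \<open>P\<close>: mass $s P(D)$ is moved to each of
  \<open>N\<close> points off the diagonal strip. The further points that are removed from \<open>P\<close> are discarded from
  the estimate.
\<close>
definition swapped :: "real \<Rightarrow> real \<Rightarrow> ((real ^ 'd) ^ 'n) set \<Rightarrow>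
    ((real ^ 'd) ^ 'n) measure \<Rightarrow> ((real ^ 'd) ^ 'n) measure \<Rightarrow> bool" where
  "swapped \<beta> s D P P' \<longleftrightarrow>
    (\<forall>c\<in>borel_measurable borel. \<forall>B. (\<forall>x. x \<notin> near_diagonal \<beta> \<longrightarrow> c x \<le> B) \<longrightarrow>
      (\<integral>\<^sup>+x. c x \<partial>P') + ennreal s * (\<integral>\<^sup>+x. c x * indicator D x \<partial>P)
      \<le> (\<integral>\<^sup>+x. c x \<partial>P) + ennreal (s * measure P D * real CARD('n)) * B)"

text \<open>The further points are drawn from \<open>A\<close>, and \<open>\<kappa>\<close> bounds
  from below the mass left at each stage. Hypothesis \<open>weight\<close> keeps the density of all
  that is removed from \<open>P\<close> at most 1: \<open>s\<close> on \<open>D\<close> for the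
  first point and at most \<open>s P(D) / \<kappa>^(N-1)\<close> on \<open>A\<close> for each
  further one. The lemma serves twice, with \<open>A\<close> the whole space and a small
  \<open>s\<close>, and with \<open>A\<close> the complement of the strip and
  \<open>s = 1\<close>.\<close>

lemma swap_step:
  fixes P :: "((real ^ 'd) ^ 'n) measure" and \<kappa> s \<beta> :: real
  defines "N \<equiv> CARD('n)"
  assumes P: "P \<in> plans \<rho>" and D [measurable]: "D \<in> sets borel" and A [measurable]: "A \<in> sets borel"
    and \<kappa>: "0 < \<kappa>" and s: "0 \<le> s"
    and room: "\<kappa> + (real N - 1) * (real N * (real N - 1) * concentration \<rho> \<beta>) \<le> measure P A"
    and weight: "\<And>x. s * indicator D x
        + (real N - 1) * (s * measure P D / \<kappa> ^ (N - 1)) * indicator A x \<le> 1"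
  shows "\<exists>P'\<in>plans \<rho>. swapped \<beta> s D P P'"
proof -
  obtain \<tau> :: "'n \<Rightarrow> 'n \<Rightarrow> 'n" where \<tau>: "\<And>k. inj (\<tau> k)" "\<And>i. bij (\<lambda>k. \<tau> k i)"
    using latin_square_exists[where 'n = 'n] by blast
  interpret P: prob_space P using P by (rule prob_space_plan)
  have sP [measurable_cong, simp]: "sets P = sets borel" using P by (rule sets_plan)
  have spP [simp]: "space P = UNIV" using sets_eq_imp_space_eq[OF sP] by simp
  \<comment> \<open>An arbitrary index names the first point; \<open>I\<close> indexes the
    others.\<close>
  define j0 :: 'n where "j0 = undefined"
  define I where "I = - {j0}"
  have cardI: "card I = N - 1" by (simp add: I_def N_def card_Diff_singleton Compl_eq_Diff_UNIV)
  have N: "N \<ge> 1" using zero_less_card_finite[where 'a = 'n] by (simp add: N_def Suc_leI)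
  have N1: "ennreal (real N - 1) = of_nat (N - 1)"
    using N by (simp add: ennreal_of_nat_eq_real_of_nat of_nat_diff)
  define Q where "Q = (\<Pi>\<^sub>M i\<in>I. P)"
  interpret Q: prob_space Q unfolding Q_def by (intro prob_space_PiM P.prob_space_axioms)
  define E where "E = P \<Otimes>\<^sub>M Q"
  define sep where "sep = (separated (cross_close \<beta>) A I :: _ \<Rightarrow> ('n \<Rightarrow> (real ^ 'd) ^ 'n) \<Rightarrow> _)"
  have R: "Measurable.pred (P \<Otimes>\<^sub>M P) (\<lambda>(x, y). cross_close \<beta> x y)"
    using pred_cross_close[of \<beta>] unfolding measurable_cong_sets[OF sets_pair_measure_cong[OF sP sP] refl] .
  have comp [measurable]: "(\<lambda>Y. Y j) \<in> Q \<rightarrow>\<^sub>M P" if "j \<in> I" for j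
    using that unfolding Q_def by measurable
  have sepM [measurable]: "Measurable.pred E (\<lambda>z. sep (fst z) (snd z))"
    unfolding sep_def E_def using A sP
    by (intro pred_separated[OF R]) (auto intro!: measurable_compose[OF measurable_snd comp])
  \<comment> \<open>The probability that independent draws from \<open>P\<close> are admissible
    after \<open>x\<close>; by \<open>emeasure_separated_ge\<close> it is at least
    \<open>\<kappa>^(N-1)\<close>.\<close>
  define t where "t x = emeasure Q {Y \<in> space Q. sep x Y}" for x
  have sepx: "Measurable.pred Q (sep x)" for x
    unfolding sep_def using A sP by (intro pred_separated[OF R, where f = "\<lambda>_. x"]) auto
  have t_eq: "t x = (\<integral>\<^sup>+Y. indicator {z. sep (fst z) (snd z)} (x, Y) \<partial>Q)" for x
  proof -
    have "t x = (\<integral>\<^sup>+Y. indicator {Y \<in> space Q. sep x Y} Y \<partial>Q)"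
      unfolding t_def using sepx by (intro nn_integral_indicator[symmetric] predE)
    also have "\<dots> = (\<integral>\<^sup>+Y. indicator {z. sep (fst z) (snd z)} (x, Y) \<partial>Q)"
      by (intro nn_integral_cong) (simp add: indicator_def)
    finally show ?thesis .
  qed
  have t [measurable]: "t \<in> borel_measurable borel"
  proof -
    have "(\<lambda>x. \<integral>\<^sup>+Y. indicator {z. sep (fst z) (snd z)} (x, Y) \<partial>Q) \<in> borel_measurable P"
      using sepM unfolding E_def by (intro Q.borel_measurable_nn_integral_fst) simp
    then show ?thesis unfolding t_eq[symmetric] by (simp cong: measurable_cong_sets)
  qed
  have t_ge: "ennreal (\<kappa> ^ (N - 1)) \<le> t x" for x
    unfolding t_def sep_def Q_def cardI[symmetric]
  proof (rule emeasure_separated_ge[OF P.prob_space_axioms R cross_close_sym])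
    show "measure P {y \<in> space P. cross_close \<beta> x y} \<le> real N * (real N - 1) * concentration \<rho> \<beta>" for x
      using measure_cross_close_le[OF P, of \<beta> x] by (simp add: N_def)
    show "\<kappa> + real (card I) * (real N * (real N - 1) * concentration \<rho> \<beta>) \<le> measure P A"
      using room N by (simp add: cardI of_nat_diff)
  qed (use A sP \<kappa> in auto)
  have t_pos: "t x \<noteq> 0" for x
    using t_ge[of x] zero_less_power[OF \<kappa>, of "N - 1"] by (auto simp: ennreal_eq_0_iff)
  have t_fin: "t x \<noteq> \<infinity>" for x
    unfolding t_def using Q.emeasure_finite by simp
  \<comment> \<open>Dividing by \<open>t\<close> makes the law of the first point exactly \<open>s P|\<^sub>D\<close>.\<close>
  define w where "w z = ennreal s * indicator D (fst z) * (if sep (fst z) (snd z) then inverse (t (fst z)) else 0)" for z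
  have w [measurable]: "w \<in> borel_measurable E"
  proof -
    have [measurable]: "fst \<in> E \<rightarrow>\<^sub>M borel"
      unfolding E_def by measurable
    show ?thesis unfolding w_def[abs_def] by measurable
  qed
  \<comment> \<open>\<open>J\<close> is left unnormalised; its total mass is
    \<open>s P(D)\<close>.\<close>
  define J where "J = density E w"
  define X where "X j z = (if j = j0 then fst z else snd z j)" for j :: 'n and z :: "((real ^ 'd) ^ 'n) \<times> ('n \<Rightarrow> (real ^ 'd) ^ 'n)"
  have XE: "X j \<in> E \<rightarrow>\<^sub>M borel" for j
  proof (cases "j = j0")
    case True
    then show ?thesis unfolding X_def[abs_def] E_def by simp measurable
  next
    case False
    then have "(\<lambda>z. snd z j) \<in> P \<Otimes>\<^sub>M Q \<rightarrow>\<^sub>M P"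
      by (intro measurable_compose[OF measurable_snd comp]) (simp add: I_def)
    with False show ?thesis unfolding X_def[abs_def] E_def using sP by (simp cong: measurable_cong_sets)
  qed
  have XJ [measurable]: "X j \<in> borel_measurable J" for j
    using XE unfolding J_def by simp
  have int0: "(\<integral>\<^sup>+z. f (fst z) \<partial>J) = ennreal s * (\<integral>\<^sup>+x. f x * indicator D x \<partial>P)"
    if f [measurable]: "f \<in> borel_measurable borel" for f
  proof -
    have fE: "(\<lambda>z. f (fst z)) \<in> borel_measurable E"
      unfolding E_def by measurable
    have "(\<integral>\<^sup>+z. f (fst z) \<partial>J) = (\<integral>\<^sup>+z. w z * f (fst z) \<partial>E)"
      unfolding J_def using fE by (intro nn_integral_density) auto
    also have "\<dots> = (\<integral>\<^sup>+x. \<integral>\<^sup>+Y. w (x, Y) * f x \<partial>Q \<partial>P)"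
      using w fE unfolding E_def by (subst Q.nn_integral_fst[symmetric]) auto
    also have "\<dots> = (\<integral>\<^sup>+x. ennreal s * (f x * indicator D x) \<partial>P)"
    proof (rule nn_integral_cong)
      fix x
      have "(\<integral>\<^sup>+Y. w (x, Y) * f x \<partial>Q) =
          (\<integral>\<^sup>+Y. (ennreal s * indicator D x * f x * inverse (t x)) * indicator {Y \<in> space Q. sep x Y} Y \<partial>Q)"
        by (intro nn_integral_cong) (auto simp: w_def indicator_def ac_simps)
      also have "\<dots> = ennreal s * indicator D x * f x * inverse (t x) * t x"
        unfolding t_def using sepx by (intro nn_integral_cmult_indicator) simp
      also have "\<dots> = ennreal s * (f x * indicator D x) * (t x * inverse (t x))"
        by (simp add: ac_simps)
      also have "t x * inverse (t x) = 1"
        using t_pos[of x] t_fin[of x] ennreal_divide_self[of "t x"]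
        by (simp add: divide_ennreal_def top.not_eq_extremum)
      finally show "(\<integral>\<^sup>+Y. w (x, Y) * f x \<partial>Q) = ennreal s * (f x * indicator D x)" by simp
    qed
    also have "\<dots> = ennreal s * (\<integral>\<^sup>+x. f x * indicator D x \<partial>P)"
      by (intro nn_integral_cmult) measurable
    finally show ?thesis .
  qed
  have J_total: "(\<integral>\<^sup>+z. 1 \<partial>J) = ennreal (s * measure P D)"
    using int0[of "\<lambda>_. 1"] s by (simp add: P.emeasure_eq_measure ennreal_mult del: nn_integral_const)
  \<comment> \<open>Bound, proved in \<open>e1\<close>, for the density with respect to
    \<open>P\<close> of the law of each further point.\<close>
  define K where "K = s * measure P D / \<kappa> ^ (N - 1)"
  have K: "0 \<le> K" using s \<kappa> by (simp add: K_def)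
  have e0: "emeasure J (X j0 -` B \<inter> space J) = ennreal (s * measure P (D \<inter> B))"
    if B [measurable]: "B \<in> sets borel" for B
  proof -
    have "emeasure J (X j0 -` B \<inter> space J) = (\<integral>\<^sup>+z. indicator (X j0 -` B \<inter> space J) z \<partial>J)"
      using measurable_sets[OF XJ B] by (rule nn_integral_indicator[symmetric])
    also have "\<dots> = (\<integral>\<^sup>+z. indicator B (fst z) \<partial>J)"
      by (intro nn_integral_cong) (simp add: X_def indicator_def)
    also have "\<dots> = ennreal s * (\<integral>\<^sup>+x. indicator B x * indicator D x \<partial>P)"
      by (rule int0) simp
    also have "(\<integral>\<^sup>+x. indicator B x * indicator D x \<partial>P) = (\<integral>\<^sup>+x. indicator (D \<inter> B) x \<partial>P)"
      by (intro nn_integral_cong) (auto simp: indicator_def)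
    also have "ennreal s * (\<integral>\<^sup>+x. indicator (D \<inter> B) x \<partial>P) = ennreal (s * measure P (D \<inter> B))"
      using s by (simp add: P.emeasure_eq_measure ennreal_mult sP)
    finally show ?thesis .
  qed
  have e1: "emeasure J (X j -` B \<inter> space J) \<le> ennreal (K * measure P (A \<inter> B))"
    if B [measurable]: "B \<in> sets borel" and j: "j \<in> I" for B j
  proof -
    let ?C = "{Y \<in> space Q. Y j \<in> A \<inter> B}"
    have C: "?C \<in> sets Q"
      using measurable_sets[OF comp[OF j], of "A \<inter> B"] sP by (simp add: vimage_def Int_def conj_commute)
    have "emeasure Q ?C = emeasure (distr Q P (\<lambda>Y. Y j)) (A \<inter> B)"
      using j by (subst emeasure_distr) (auto simp: sP intro!: arg_cong2[where f = emeasure])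
    also have "distr Q P (\<lambda>Y. Y j) = P"
      unfolding Q_def using j by (intro distr_PiM_component P.prob_space_axioms)
    finally have QC: "emeasure Q ?C = ennreal (measure P (A \<inter> B))"
      by (simp add: P.emeasure_eq_measure)
    have XB: "X j -` B \<inter> space E \<in> sets E"
      using measurable_sets[OF XE B] .
    have "emeasure J (X j -` B \<inter> space J) = (\<integral>\<^sup>+z. w z * indicator (X j -` B \<inter> space E) z \<partial>E)"
      unfolding J_def using XB by (simp add: emeasure_density)
    \<comment> \<open>Of the separation only the condition that \<open>Y j\<close> lies in
      \<open>A\<close> is kept; with \<open>t\<close> bounded below, a product indicator
      remains.\<close>
    also have "\<dots> \<le> (\<integral>\<^sup>+z. ennreal (s / \<kappa> ^ (N - 1)) * indicator (D \<times> ?C) z \<partial>E)"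
    proof (rule nn_integral_mono)
      fix z assume z: "z \<in> space E"
      have "inverse (t (fst z)) \<le> inverse (ennreal (\<kappa> ^ (N - 1)))"
        using t_ge by (rule ennreal_inverse_antimono)
      also have "\<dots> = ennreal (1 / \<kappa> ^ (N - 1))"
        using \<kappa> by (simp add: inverse_ennreal divide_inverse)
      finally have "ennreal s * inverse (t (fst z)) \<le> ennreal s * ennreal (1 / \<kappa> ^ (N - 1))"
        by (intro mult_left_mono) auto
      also have "\<dots> = ennreal (s / \<kappa> ^ (N - 1))"
        using s \<kappa> by (subst ennreal_mult[symmetric]) auto
      finally have *: "ennreal s * inverse (t (fst z)) \<le> ennreal (s / \<kappa> ^ (N - 1))" .
      have "snd z \<in> ?C" if "sep (fst z) (snd z)" "X j z \<in> B"
        using that j z by (auto simp: sep_def separated_def X_def I_def E_def space_pair_measure)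
      with * show "w z * indicator (X j -` B \<inter> space E) z \<le> ennreal (s / \<kappa> ^ (N - 1)) * indicator (D \<times> ?C) z"
        by (cases z) (auto simp: w_def indicator_def)
    qed
    also have "\<dots> = ennreal (s / \<kappa> ^ (N - 1)) * (emeasure P D * emeasure Q ?C)"
      using C D sP unfolding E_def
      by (subst nn_integral_cmult_indicator) (auto simp: Q.emeasure_pair_measure_Times)
    also have "\<dots> = ennreal (K * measure P (A \<inter> B))"
      unfolding QC P.emeasure_eq_measure using s \<kappa> by (simp add: K_def ennreal_mult[symmetric])
    finally show ?thesis .
  qed
  \<comment> \<open>The hypothesis of \<open>swap_coordinates\<close>: the laws of all
    \<open>N\<close> points together do not exceed \<open>P\<close>.\<close>
  have "(\<Sum>j\<in>UNIV. emeasure J (X j -` B \<inter> space J)) \<le> emeasure P B" if B [measurable]: "B \<in> sets borel" for B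
  proof -
    have "(\<Sum>j\<in>UNIV. emeasure J (X j -` B \<inter> space J)) =
        emeasure J (X j0 -` B \<inter> space J) + (\<Sum>j\<in>I. emeasure J (X j -` B \<inter> space J))"
      unfolding I_def by (subst sum.remove[of _ j0]) (auto simp: Compl_eq_Diff_UNIV)
    also have "\<dots> \<le> ennreal (s * measure P (D \<inter> B)) + (\<Sum>j\<in>I. ennreal (K * measure P (A \<inter> B)))"
      using e0[OF B] e1[OF B] by (intro add_mono sum_mono) auto
    also have "\<dots> = ennreal s * emeasure P (D \<inter> B) + ennreal ((real N - 1) * K) * emeasure P (A \<inter> B)"
      using s K N by (simp add: cardI P.emeasure_eq_measure ennreal_mult N1 mult.assoc)
    also have "\<dots> = (\<integral>\<^sup>+x. ennreal s * indicator (D \<inter> B) x + ennreal ((real N - 1) * K) * indicator (A \<inter> B) x \<partial>P)"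
      by (simp add: nn_integral_add nn_integral_cmult sP)
    also have "\<dots> \<le> (\<integral>\<^sup>+x. indicator B x \<partial>P)"
    proof (rule nn_integral_mono)
      fix x
      have "ennreal (s * indicator D x + (real N - 1) * K * indicator A x) \<le> ennreal 1"
        using weight[of x] unfolding K_def by (intro ennreal_leI)
      then have "ennreal s * indicator D x + ennreal ((real N - 1) * K) * indicator A x \<le> 1"
        using s K N by (auto simp: indicator_def ennreal_plus split: if_splits)
      then show "ennreal s * indicator (D \<inter> B) x + ennreal ((real N - 1) * K) * indicator (A \<inter> B) x \<le> indicator B x"
        by (auto simp: indicator_def)
    qed
    also have "\<dots> = emeasure P B" by (simp add: sP)
    finally show ?thesis .
  qed
  from swap_coordinates[OF P XJ this \<tau>(2)] obtain P' where P': "P' \<in> plans \<rho>"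
    and bal: "\<forall>c\<in>borel_measurable borel.
      (\<integral>\<^sup>+x. c x \<partial>P') + (\<Sum>j\<in>UNIV. \<integral>\<^sup>+e. c (X j e) \<partial>J) =
      (\<integral>\<^sup>+x. c x \<partial>P) + (\<Sum>k\<in>UNIV. \<integral>\<^sup>+e. c (\<chi> i. X (\<tau> k i) e $ i) \<partial>J)"
    by (rule bexE)
  \<comment> \<open>Two coordinates of a regrouped point come from different members of the family,
    as \<open>\<tau> k\<close> is injective, and these members are not
    \<open>cross_close\<close>.\<close>
  have far: "(\<chi> i. X (\<tau> k i) z $ i) \<notin> near_diagonal \<beta>" if "sep (fst z) (snd z)" for k z
  proof
    assume "(\<chi> i. X (\<tau> k i) z $ i) \<in> near_diagonal \<beta>"
    then obtain i j where ij: "i \<noteq> j" "norm (X (\<tau> k i) z $ i - X (\<tau> k j) z $ j) < \<beta>"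
      by (auto simp: near_diagonal_def)
    then have "cross_close \<beta> (X (\<tau> k i) z) (X (\<tau> k j) z)" "\<tau> k i \<noteq> \<tau> k j"
      using \<tau>(1)[of k] by (auto simp: cross_close_def inj_def)
    then show False
      using that cross_close_sym[of \<beta> "X (\<tau> k i) z" "X (\<tau> k j) z"]
      by (auto simp: sep_def separated_def X_def I_def split: if_splits)
  qed
  show ?thesis
    unfolding swapped_def
  proof (intro bexI[OF _ P'] ballI allI impI)
    fix c :: "(real ^ 'd) ^ 'n \<Rightarrow> ennreal" and B
    assume c [measurable]: "c \<in> borel_measurable borel" and B: "\<forall>x. x \<notin> near_diagonal \<beta> \<longrightarrow> c x \<le> B"
    have "ennreal s * (\<integral>\<^sup>+x. c x * indicator D x \<partial>P) = (\<integral>\<^sup>+z. c (X j0 z) \<partial>J)"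
      using int0[OF c] by (simp add: X_def)
    also have "\<dots> \<le> (\<Sum>j\<in>UNIV. \<integral>\<^sup>+z. c (X j z) \<partial>J)"
      by (intro member_le_sum) auto
    finally have "(\<integral>\<^sup>+x. c x \<partial>P') + ennreal s * (\<integral>\<^sup>+x. c x * indicator D x \<partial>P) \<le>
        (\<integral>\<^sup>+x. c x \<partial>P) + (\<Sum>k\<in>UNIV. \<integral>\<^sup>+z. c (\<chi> i. X (\<tau> k i) z $ i) \<partial>J)"
      unfolding bal[rule_format, OF c, symmetric] by (intro add_left_mono)
    also have "\<dots> \<le> (\<integral>\<^sup>+x. c x \<partial>P) + (\<Sum>k\<in>(UNIV :: 'n set). B * ennreal (s * measure P D))"
    proof (intro add_left_mono sum_mono)
      fix k
      have [measurable]: "(\<lambda>z. \<chi> i. X (\<tau> k i) z $ i) \<in> borel_measurable E"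
        by (intro measurable_vec_lambda measurable_compose[OF XE measurable_vec_nth])
      have "(\<integral>\<^sup>+z. c (\<chi> i. X (\<tau> k i) z $ i) \<partial>J) = (\<integral>\<^sup>+z. w z * c (\<chi> i. X (\<tau> k i) z $ i) \<partial>E)"
        unfolding J_def by (intro nn_integral_density) measurable
      \<comment> \<open>\<open>w\<close> vanishes wherever the draws are not separated, so
        \<open>far\<close> covers all that counts.\<close>
      also have "\<dots> \<le> (\<integral>\<^sup>+z. w z * B \<partial>E)"
        using far B by (intro nn_integral_mono) (auto simp: w_def intro!: mult_left_mono)
      also have "\<dots> = (\<integral>\<^sup>+z. B * 1 \<partial>J)"
        unfolding J_def by (subst nn_integral_density) (auto intro!: nn_integral_cong)
      also have "\<dots> = B * (\<integral>\<^sup>+z. 1 \<partial>J)"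
        by (rule nn_integral_cmult) simp
      also have "\<dots> = B * ennreal (s * measure P D)" by (simp only: J_total)
      finally show "(\<integral>\<^sup>+z. c (\<chi> i. X (\<tau> k i) z $ i) \<partial>J) \<le> B * ennreal (s * measure P D)" .
    qed
    also have "(\<Sum>k\<in>(UNIV :: 'n set). B * ennreal (s * measure P D)) = ennreal (s * measure P D * real CARD('n)) * B"
      using s by (simp add: N_def ennreal_mult ac_simps flip: ennreal_of_nat_eq_real_of_nat)
    finally show "(\<integral>\<^sup>+x. c x \<partial>P') + ennreal s * (\<integral>\<^sup>+x. c x * indicator D x \<partial>P)
      \<le> (\<integral>\<^sup>+x. c x \<partial>P) + ennreal (s * measure P D * real CARD('n)) * B" .
  qed
qed

section \<open>Plans that do not charge the diagonal strip\<close>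

text \<open>The case where \<open>A\<close> is the whole space. That \<open>s\<close> depends
  neither on \<open>P\<close> nor on \<open>D\<close> gives the later iteration a fixed rate of
  contraction.\<close>

lemma uniform_swap_step:
  fixes \<rho> :: "(real ^ 'd) measure" and \<beta> :: real
  defines "N \<equiv> CARD('n)"
  assumes conc: "(real N - 1) * (real N * (real N - 1) * concentration \<rho> \<beta>) < 1"
  shows "\<exists>s>0. s \<le> 1 \<and> (\<forall>P :: ((real ^ 'd) ^ 'n) measure \<in> plans \<rho>.
    \<forall>D\<in>sets borel. \<exists>P'\<in>plans \<rho>. swapped \<beta> s D P P')"
proof -
  define \<kappa> where "\<kappa> = 1 - (real N - 1) * (real N * (real N - 1) * concentration \<rho> \<beta>)"
  define r where "r = (real N - 1) / \<kappa> ^ (N - 1)"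
  \<comment> \<open>Solves \<open>s + s r = 1\<close>, the worst case of \<open>weight\<close>,
    attained on \<open>D\<close> when \<open>D\<close> has full mass.\<close>
  define s where "s = 1 / (1 + r)"
  have \<kappa>: "0 < \<kappa>" using conc by (simp add: \<kappa>_def)
  have "real N \<ge> 1" using zero_less_card_finite[where 'a = 'n] by (simp add: N_def Suc_leI)
  then have r: "0 \<le> r" using \<kappa> by (simp add: r_def)
  then have s: "0 < s" "s \<le> 1" "s * (1 + r) = 1" by (auto simp: s_def)
  show ?thesis
  proof (intro exI[of _ s] conjI s(1,2) ballI)
    fix P :: "((real ^ 'd) ^ 'n) measure" and D :: "((real ^ 'd) ^ 'n) set"
    assume P: "P \<in> plans \<rho>" and D: "D \<in> sets borel"
    interpret P: prob_space P using P by (rule prob_space_plan)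
    have "measure P UNIV = 1"
      using P.prob_space sets_eq_imp_space_eq[OF sets_plan[OF P]] by simp
    then have room: "\<kappa> + (real N - 1) * (real N * (real N - 1) * concentration \<rho> \<beta>) \<le> measure P UNIV"
      by (simp add: \<kappa>_def)
    have weight: "s * indicator D x
        + (real N - 1) * (s * measure P D / \<kappa> ^ (N - 1)) * indicator UNIV x \<le> 1" for x
    proof -
      have "(real N - 1) * (s * measure P D / \<kappa> ^ (N - 1)) = s * r * measure P D"
        by (simp add: r_def)
      also have "\<dots> \<le> s * r * 1"
        using s r by (intro mult_left_mono) auto
      finally show ?thesis using s by (auto simp: indicator_def algebra_simps)
    qed
    show "\<exists>P'\<in>plans \<rho>. swapped \<beta> s D P P'"
      by (rule swap_step[OF P D sets.top[of borel, unfolded space_borel] \<kappa>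
          less_imp_le[OF s(1)] room[unfolded N_def] weight[unfolded N_def]])
  qed
qed

text \<open>The test function is the indicator of the strip; it vanishes off the strip, so
  \<open>B = 0\<close> is allowed.\<close>

lemma swap_measure_near_diagonal:
  fixes P P' :: "((real ^ 'd) ^ 'n) measure"
  assumes P: "P \<in> plans \<rho>" and P': "P' \<in> plans \<rho>" and s: "0 \<le> s"
    and le: "swapped \<beta> s (near_diagonal \<beta>) P P'"
  shows "measure P' (near_diagonal \<beta>) \<le> (1 - s) * measure P (near_diagonal \<beta>)"
proof -
  let ?D = "near_diagonal \<beta> :: ((real ^ 'd) ^ 'n) set"
  interpret P: prob_space P using P by (rule prob_space_plan)
  interpret P': prob_space P' using P' by (rule prob_space_plan)
  have "emeasure P' ?D + ennreal s * emeasure P ?D \<le> emeasure P ?D"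
    using le[unfolded swapped_def, rule_format, of "indicator ?D" 0] sets_plan[OF P] sets_plan[OF P']
    by (simp add: indicator_inter_arith[symmetric])
  then have "ennreal (measure P' ?D + s * measure P ?D) \<le> ennreal (measure P ?D)"
    using s by (simp add: P.emeasure_eq_measure P'.emeasure_eq_measure ennreal_mult)
  then show ?thesis by (simp add: ennreal_le_iff algebra_simps)
qed

text \<open>Provides a competitor of finite cost, since the costs are bounded off the strip.\<close>

lemma plan_off_diagonal_exists:
  fixes P :: "((real ^ 'd) ^ 'n) measure" and \<beta> :: real
  defines "N \<equiv> CARD('n)"
  assumes P: "P \<in> plans \<rho>"
    and conc: "(real N - 1) * (real N * (real N - 1) * concentration \<rho> \<beta>) < 1"
  shows "\<exists>P' :: ((real ^ 'd) ^ 'n) measure \<in> plans \<rho>. emeasure P' (near_diagonal \<beta>) = 0"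
proof -
  let ?D = "near_diagonal \<beta> :: ((real ^ 'd) ^ 'n) set"
  define \<kappa> where "\<kappa> = 1 - (real N - 1) * (real N * (real N - 1) * concentration \<rho> \<beta>)"
  have N: "real N \<ge> 1" using zero_less_card_finite[where 'a = 'n] by (simp add: N_def Suc_leI)
  have \<kappa>: "0 < \<kappa>" using conc by (simp add: \<kappa>_def)
  obtain s where s: "0 < s" "s \<le> 1" and swap: "\<forall>P :: ((real ^ 'd) ^ 'n) measure \<in> plans \<rho>.
      \<forall>D\<in>sets borel. \<exists>P'\<in>plans \<rho>. swapped \<beta> s D P P'"
    using uniform_swap_step[OF conc[unfolded N_def]] by blast
  have decay: "\<exists>P\<in>plans \<rho>. measure P ?D \<le> (1 - s) ^ n" for n
  proof (induction n)
    case 0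
    show ?case using P prob_space.prob_le_1[OF prob_space_plan[OF P]] by auto
  next
    case (Suc n)
    then obtain P where P: "P \<in> plans \<rho>" and le: "measure P ?D \<le> (1 - s) ^ n" by blast
    from bspec[OF bspec[OF swap P] near_diagonal_borel[of \<beta>]] obtain P' where P': "P' \<in> plans \<rho>"
      and le': "swapped \<beta> s ?D P P'"
      by (rule bexE)
    have "measure P' ?D \<le> (1 - s) * measure P ?D"
      using s by (intro swap_measure_near_diagonal[OF P P' _ le']) simp
    also have "\<dots> \<le> (1 - s) * (1 - s) ^ n" using le s by (intro mult_left_mono) auto
    finally show ?case using P' by auto
  qed
  \<comment> \<open>The first bound leaves room \<open>\<kappa> / 2\<close> when drawing off the
    strip; the second keeps the density removed there at most 1.\<close>
  define \<epsilon> where "\<epsilon> = min (\<kappa> / 2) ((\<kappa> / 2) ^ (N - 1) / real N)"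
  have "0 < \<epsilon>" using \<kappa> N by (simp add: \<epsilon>_def)
  then obtain n where "(1 - s) ^ n < \<epsilon>"
    using s by (metis real_arch_pow_inv diff_less_eq less_add_same_cancel1)
  with decay[of n] obtain P where P: "P \<in> plans \<rho>" and small: "measure P ?D < \<epsilon>" by force
  interpret P: prob_space P using P by (rule prob_space_plan)
  have "measure P (- ?D) = 1 - measure P ?D"
    using P.prob_compl[of ?D] sets_plan[OF P] sets_eq_imp_space_eq[OF sets_plan[OF P]]
    by (simp add: Compl_eq_Diff_UNIV)
  moreover have "measure P ?D < \<kappa> / 2" using small by (simp add: \<epsilon>_def)
  moreover have "(real N - 1) * (real N * (real N - 1) * concentration \<rho> \<beta>) = 1 - \<kappa>"
    by (simp add: \<kappa>_def)
  ultimately have room: "\<kappa> / 2 + (real N - 1) * (real N * (real N - 1) * concentration \<rho> \<beta>) \<le> measure P (- ?D)"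
    by linarith
  \<comment> \<open>The strip and its complement are disjoint, so the two terms never add up at one
    point and \<open>s = 1\<close> is possible.\<close>
  have weight: "1 * indicator ?D x
      + (real N - 1) * (1 * measure P ?D / (\<kappa> / 2) ^ (N - 1)) * indicator (- ?D) x \<le> 1" for x
  proof -
    have "(real N - 1) * measure P ?D \<le> real N * ((\<kappa> / 2) ^ (N - 1) / real N)"
      using small N by (intro mult_mono) (auto simp: \<epsilon>_def)
    also have "\<dots> = (\<kappa> / 2) ^ (N - 1)" using N by simp
    finally have "(real N - 1) * measure P ?D / (\<kappa> / 2) ^ (N - 1) \<le> 1"
      using \<kappa> by (subst divide_le_eq_1_pos) auto
    then show ?thesis by (simp add: indicator_def)
  qed
  have D: "- ?D \<in> sets borel" by measurable
  obtain P' where P': "P' \<in> plans \<rho>"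
    and le: "swapped \<beta> 1 ?D P P'"
    using swap_step[OF P near_diagonal_borel D half_gt_zero[OF \<kappa>] zero_le_one
        room[unfolded N_def] weight[unfolded N_def]]
    by (rule bexE)
  have "measure P' ?D = 0"
    using swap_measure_near_diagonal[OF P P' zero_le_one le] measure_nonneg[of P' ?D] by simp
  interpret P': prob_space P' using P' by (rule prob_space_plan)
  have "emeasure P' ?D = 0"
    using \<open>measure P' ?D = 0\<close> by (simp add: P'.emeasure_eq_measure)
  with P' show ?thesis by (rule bexI[rotated])
qed

section \<open>Measurability and bounds of the costs, and the inverse of
  \<open>\<phi>\<close>\<close>

lemma card_less_pairs: "real (card {(i :: 'n, j). i < j}) =
    real CARD('n::{finite,linorder}) * (real CARD('n) - 1) / 2"
proof -
  let ?L = "{(i :: 'n, j). i < j}"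
  have "card (prod.swap ` ?L) = card ?L"
    by (intro card_image inj_onI) auto
  moreover have off: "card {(i :: 'n, j :: 'n). i \<noteq> j} = CARD('n) * (CARD('n) - 1)"
    by (rule card_off_diagonal)
  moreover have "{(i :: 'n, j). i \<noteq> j} = ?L \<union> prod.swap ` ?L" "?L \<inter> prod.swap ` ?L = {}"
    by (auto simp: image_iff)
  ultimately have "2 * card ?L = CARD('n) * (CARD('n) - 1)"
    using card_Un_disjoint[of ?L "prod.swap ` ?L"] off by simp
  then have "2 * real (card ?L) = real (CARD('n) * (CARD('n) - 1))"
    by (metis of_nat_mult of_nat_numeral)
  then show ?thesis
    by (simp add: of_nat_diff Suc_leI)
qed

lemma measurable_phi_ext:
  assumes "continuous_on {0<..} \<phi>"
  shows "(\<lambda>x :: 'a::euclidean_space. phi_ext \<phi> (norm x)) \<in> borel_measurable borel"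
proof -
  \<comment> \<open>Continuity of \<open>\<phi>\<close> is known on \<open>{0<..}\<close> only, so
    it is replaced by 0 elsewhere; the value at 0 comes from \<open>phi_ext\<close>.\<close>
  have "(\<lambda>t. indicator {0<..} t *\<^sub>R \<phi> t) \<in> borel_measurable borel"
    using assms by (intro borel_measurable_continuous_on_indicator) auto
  then have [measurable]: "(\<lambda>x :: 'a. indicator {0<..} (norm x) *\<^sub>R \<phi> (norm x)) \<in> borel_measurable borel"
    by (rule measurable_compose[rotated]) measurable
  have "(\<lambda>x :: 'a. phi_ext \<phi> (norm x)) =
      (\<lambda>x. if norm x = 0 then \<infinity> else ennreal (indicator {0<..} (norm x) *\<^sub>R \<phi> (norm x)))"
    by (auto simp: phi_ext_def)
  also have "\<dots> \<in> borel_measurable borel" by measurable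
  finally show ?thesis .
qed

lemma
  assumes "continuous_on {0<..} \<phi>"
  shows measurable_cost: "(cost \<phi> :: (real ^ 'd) ^ 'n::{finite,linorder} \<Rightarrow> _) \<in> borel_measurable borel"
    and measurable_trunc_cost: "(trunc_cost \<phi> \<alpha> :: (real ^ 'd) ^ 'n::{finite,linorder} \<Rightarrow> _) \<in> borel_measurable borel"
proof -
  have [measurable]: "(\<lambda>x :: (real ^ 'd) ^ 'n::{finite,linorder}. phi_ext \<phi> (norm (x $ i - x $ j))) \<in> borel_measurable borel" for i j
    by (rule measurable_compose[OF _ measurable_phi_ext[OF assms]]) measurable
  show "(cost \<phi> :: (real ^ 'd) ^ 'n::{finite,linorder} \<Rightarrow> _) \<in> borel_measurable borel"
    unfolding cost_def[abs_def] by (intro borel_measurable_sum) (clarsimp, measurable)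
  show "(trunc_cost \<phi> \<alpha> :: (real ^ 'd) ^ 'n::{finite,linorder} \<Rightarrow> _) \<in> borel_measurable borel"
    unfolding trunc_cost_def[abs_def] by (intro borel_measurable_sum) (clarsimp, measurable)
qed

text \<open>Lets the upper bound for \<open>cost\<close> off the strip pass to
  \<open>trunc_cost\<close>, and the lower bound for \<open>trunc_cost\<close> on
  \<open>near_diagonal \<alpha>\<close> pass to \<open>cost\<close>.\<close>

lemma trunc_cost_le_cost: "trunc_cost \<phi> \<alpha> x \<le> cost \<phi> x"
  unfolding trunc_cost_def cost_def by (intro sum_mono) auto

lemma cost_le_off_diagonal:
  fixes x :: "(real ^ 'd) ^ 'n::{finite,linorder}"
  assumes phi: "strict_antimono_on {0<..} \<phi>" and \<beta>: "0 < \<beta>" "0 \<le> \<phi> \<beta>"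
    and x: "x \<notin> near_diagonal \<beta>"
  shows "cost \<phi> x \<le> ennreal (real CARD('n) * (real CARD('n) - 1) / 2 * \<phi> \<beta>)"
proof -
  have "cost \<phi> x \<le> (\<Sum>(i, j) \<in> {(i :: 'n, j). i < j}. ennreal (\<phi> \<beta>))"
    unfolding cost_def
  proof (intro sum_mono, clarify)
    fix i j :: 'n assume "i < j"
    then have le: "\<beta> \<le> norm (x $ i - x $ j)"
      using x unfolding near_diagonal_def mem_Collect_eq by (metis less_irrefl linorder_not_le)
    then have "\<phi> (norm (x $ i - x $ j)) \<le> \<phi> \<beta>"
    proof (cases "\<beta> = norm (x $ i - x $ j)")
      case False
      with le \<beta>(1) show ?thesis
        by (intro less_imp_le monotone_onD[OF phi]) (simp_all del: zero_less_norm_iff)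
    qed simp
    then show "phi_ext \<phi> (norm (x $ i - x $ j)) \<le> ennreal (\<phi> \<beta>)"
      using le \<beta> by (auto simp: phi_ext_def intro: ennreal_leI)
  qed
  also have "\<dots> = ennreal (real (card {(i :: 'n, j). i < j}) * \<phi> \<beta>)"
    using \<beta>(2) by (simp add: ennreal_mult ennreal_of_nat_eq_real_of_nat case_prod_unfold)
  finally show ?thesis by (simp add: card_less_pairs)
qed

text \<open>A single close pair suffices, as its term already reaches the truncation level.\<close>

lemma trunc_cost_ge_near_diagonal:
  fixes x :: "(real ^ 'd) ^ 'n::{finite,linorder}"
  assumes phi: "strict_antimono_on {0<..} \<phi>" and x: "x \<in> near_diagonal \<alpha>"
  shows "ennreal (\<phi> \<alpha>) \<le> trunc_cost \<phi> \<alpha> x"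
proof -
  from x obtain i j where "i \<noteq> j" "norm (x $ i - x $ j) < \<alpha>"
    by (auto simp: near_diagonal_def)
  then obtain i j where ij: "i < j" "norm (x $ i - x $ j) < \<alpha>"
    by (metis linorder_neqE norm_minus_commute)
  \<comment> \<open>If the two coordinates coincide, \<open>phi_ext\<close> is infinite and the
    minimum is the truncation level itself.\<close>
  have "\<phi> \<alpha> \<le> \<phi> (norm (x $ i - x $ j))" if "x $ i \<noteq> x $ j"
    using that ij(2) by (intro less_imp_le monotone_onD[OF phi]) (auto intro: less_trans[OF _ ij(2)])
  moreover have "\<alpha> \<noteq> 0" using ij(2) norm_ge_zero[of "x $ i - x $ j"] by linarith
  ultimately have "ennreal (\<phi> \<alpha>) \<le> min (phi_ext \<phi> (norm (x $ i - x $ j))) (phi_ext \<phi> \<alpha>)"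
    by (auto simp: phi_ext_def intro!: ennreal_leI)
  also have "\<dots> \<le> trunc_cost \<phi> \<alpha> x"
    unfolding trunc_cost_def
    using ij(1) member_le_sum[of "(i, j)" "{(i :: 'n, j). i < j}"
        "\<lambda>(i, j). min (phi_ext \<phi> (norm (x $ i - x $ j))) (phi_ext \<phi> \<alpha>)"]
    by simp
  finally show ?thesis .
qed

text \<open>\<open>the_inv_into\<close> is meaningful only at attained values; \<open>y\<close> is
  attained by the intermediate value theorem, lying between \<open>\<phi> \<beta>\<close> and the
  blow-up at 0.\<close>

lemma less_at_smaller_than_inverse:
  fixes \<phi> :: "real \<Rightarrow> real"
  assumes cont: "continuous_on {0<..} \<phi>" and decr: "strict_antimono_on {0<..} \<phi>"
    and lim: "filterlim \<phi> at_top (at_right 0)"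
    and \<beta>: "0 < \<beta>" "\<phi> \<beta> \<le> y" and \<alpha>: "0 < \<alpha>" "\<alpha> < the_inv_into {0<..} \<phi> y"
  shows "y < \<phi> \<alpha>"
proof -
  have "eventually (\<lambda>t. y \<le> \<phi> t) (at_right 0)"
    using lim by (simp add: filterlim_at_top)
  moreover have "eventually (\<lambda>t. t \<in> {0<..<\<beta>}) (at_right 0)"
    using \<beta>(1) by (rule eventually_at_right_real)
  ultimately have "eventually (\<lambda>t. y \<le> \<phi> t \<and> t \<in> {0<..<\<beta>}) (at_right 0)"
    by (rule eventually_conj)
  then obtain t where t: "y \<le> \<phi> t" "0 < t" "t < \<beta>"
    using eventually_happens'[OF trivial_limit_at_right_real] by fastforce
  have "\<exists>z\<ge>t. z \<le> \<beta> \<and> \<phi> z = y"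
    using t \<beta> by (intro IVT2' continuous_on_subset[OF cont]) auto
  then obtain z where "t \<le> z" and z: "\<phi> z = y" by blast
  with t have z: "0 < z" "\<phi> z = y" by simp_all
  have "inj_on \<phi> {0<..}"
    using monotone_onD[OF decr] by (intro linorder_inj_onI) (auto, fastforce)
  then have "the_inv_into {0<..} \<phi> y = z"
    using z by (intro the_inv_into_f_eq) auto
  with \<alpha> z monotone_onD[OF decr, of \<alpha> z] show ?thesis by simp
qed

section \<open>Minimizers and the set of close coordinates\<close>

text \<open>The cost is abstract so that \<open>cost\<close> and \<open>trunc_cost\<close> are both
  covered. Exchanging on \<open>near_diagonal \<alpha>\<close>, if it has mass \<open>m > 0\<close>,
  saves at least \<open>s m a\<close> and adds at most \<open>s m N b\<close>, which is
  less.\<close>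

lemma minimizer_null_near_diagonal:
  fixes P :: "((real ^ 'd) ^ 'n) measure" and a b \<beta> :: real
  defines "N \<equiv> CARD('n)"
  assumes P: "is_minimizer c \<rho> P" and c: "c \<in> borel_measurable borel"
    and conc: "(real N - 1) * (real N * (real N - 1) * concentration \<rho> \<beta>) < 1"
    and far: "\<And>x. x \<notin> near_diagonal \<beta> \<Longrightarrow> c x \<le> ennreal b"
    and near: "\<And>x. x \<in> near_diagonal \<alpha> \<Longrightarrow> ennreal a \<le> c x"
    and b: "0 \<le> b" and ab: "real N * b < a"
  shows "emeasure P (near_diagonal \<alpha>) = 0"
proof (rule ccontr)
  assume nz: "emeasure P (near_diagonal \<alpha>) \<noteq> 0"
  let ?D = "near_diagonal \<alpha> :: ((real ^ 'd) ^ 'n) set"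
  have plan: "P \<in> plans \<rho>" and min: "\<And>P'. P' \<in> plans \<rho> \<Longrightarrow> (\<integral>\<^sup>+x. c x \<partial>P) \<le> (\<integral>\<^sup>+x. c x \<partial>P')"
    using P by (auto simp: is_minimizer_def transport_cost_def intro: INF_lower)
  interpret P: prob_space P using plan by (rule prob_space_plan)
  have [measurable_cong, simp]: "sets P = sets borel" using plan by (rule sets_plan)
  define m where "m = measure P ?D"
  have m: "0 < m" using nz by (simp add: m_def P.emeasure_eq_measure zero_less_measure_iff)
  have N: "real N \<ge> 1" using zero_less_card_finite[where 'a = 'n] by (simp add: N_def Suc_leI)
  obtain P0 :: "((real ^ 'd) ^ 'n) measure" where P0: "P0 \<in> plans \<rho>" "emeasure P0 (near_diagonal \<beta>) = 0"
    using plan_off_diagonal_exists[OF plan conc[unfolded N_def]] by (rule bexE)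
  interpret P0: prob_space P0 using P0(1) by (rule prob_space_plan)
  have "AE x in P0. x \<notin> near_diagonal \<beta>"
    using P0 sets_plan[OF P0(1)] by (intro AE_not_in) (auto simp: null_sets_def)
  then have "(\<integral>\<^sup>+x. c x \<partial>P0) \<le> (\<integral>\<^sup>+x. ennreal b \<partial>P0)"
    by (intro nn_integral_mono_AE) (auto elim!: eventually_mono intro: far)
  also have "\<dots> = ennreal b" by (simp add: P0.emeasure_space_1)
  \<comment> \<open>Finiteness allows the integral of \<open>c\<close> against \<open>P\<close> to
    be cancelled at the end.\<close>
  finally have fin: "(\<integral>\<^sup>+x. c x \<partial>P) \<noteq> \<top>"
    using min[OF P0(1)] by (auto simp: top_unique)
  obtain s where s: "0 < s" and swap: "\<forall>P :: ((real ^ 'd) ^ 'n) measure \<in> plans \<rho>.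
      \<forall>D\<in>sets borel. \<exists>P'\<in>plans \<rho>. swapped \<beta> s D P P'"
    using uniform_swap_step[OF conc[unfolded N_def]] by blast
  from bspec[OF bspec[OF swap plan] near_diagonal_borel[of \<alpha>]] obtain P' where P': "P' \<in> plans \<rho>"
    and le: "swapped \<beta> s ?D P P'"
    by (rule bexE)
  have "0 \<le> real N * b" using b N by simp
  with ab have a: "0 \<le> a" by linarith
  have "ennreal (s * m * a) = ennreal s * (\<integral>\<^sup>+x. ennreal a * indicator ?D x \<partial>P)"
    using s m a
    by (simp add: nn_integral_cmult_indicator P.emeasure_eq_measure m_def ennreal_mult ac_simps)
  also have "\<dots> \<le> ennreal s * (\<integral>\<^sup>+x. c x * indicator ?D x \<partial>P)"
    using near by (intro mult_left_mono nn_integral_mono) (auto simp: indicator_def)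
  finally have "(\<integral>\<^sup>+x. c x \<partial>P) + ennreal (s * m * a) \<le>
      (\<integral>\<^sup>+x. c x \<partial>P') + ennreal s * (\<integral>\<^sup>+x. c x * indicator ?D x \<partial>P)"
    using min[OF P'] by (rule add_mono[rotated])
  also have "\<dots> \<le> (\<integral>\<^sup>+x. c x \<partial>P) + ennreal (s * m * real N) * ennreal b"
    using le[unfolded swapped_def, rule_format, OF c far] by (simp add: m_def N_def)
  finally have "ennreal (s * m * a) \<le> ennreal (s * m * real N) * ennreal b"
    using fin by (simp add: ennreal_add_left_cancel_le)
  also have "\<dots> = ennreal (s * m * (real N * b))"
    using s m b by (simp add: ennreal_mult[symmetric] mult.assoc)
  finally have "s * m * a \<le> s * m * (real N * b)"
    using s m b by (subst (asm) ennreal_le_iff) auto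
  then show False using s m ab by simp
qed

theorem theorem2p4:
  fixes \<phi> :: "real \<Rightarrow> real"
    and \<rho> :: "(real ^ 'd) measure"
    and P :: "((real ^ 'd) ^ 'n::{finite,linorder}) measure"
    and \<alpha> \<beta> L :: real
  assumes N: "CARD('n) > 1"
    and phi_nonneg: "\<And>t. t > 0 \<Longrightarrow> \<phi> t \<ge> 0"
    and phi_cont: "continuous_on {0<..} \<phi>"
    and phi_decr: "strict_antimono_on {0<..} \<phi>"
    and phi_lim: "filterlim \<phi> at_top (at_right 0)"
    and rho: "\<rho> \<in> borel_probs"
    and conc_lim: "(concentration \<rho> \<longlongrightarrow> L) (at_right 0)"
    and L: "L < 1 / (real CARD('n) * (real CARD('n) - 1)\<^sup>2)"
    and beta_pos: "\<beta> > 0"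
    and beta: "concentration \<rho> \<beta> < 1 / (real CARD('n) * (real CARD('n) - 1)\<^sup>2)"
    and alpha_pos: "\<alpha> > 0"
    and alpha: "\<alpha> < the_inv_into {0<..} \<phi>
                     ((real CARD('n))\<^sup>2 * (real CARD('n) - 1) / 2 * \<phi> \<beta>)"
    and P: "is_minimizer (cost \<phi>) \<rho> P \<or> is_minimizer (trunc_cost \<phi> \<alpha>) \<rho> P"
  shows "spt P \<subseteq> UNIV - near_diagonal \<alpha>"
proof -
  let ?N = "real CARD('n)"
  have N2: "?N \<ge> 2" using N by linarith
  \<comment> \<open>The bound on the concentration says that \<open>N - 1\<close> points, each
    excluding mass at most \<open>N(N-1)\<close> times the concentration, exclude less than 1 in
    total.\<close>
  have conc: "(?N - 1) * (?N * (?N - 1) * concentration \<rho> \<beta>) < 1"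
  proof -
    have "0 < ?N * (?N - 1)\<^sup>2" using N2 by simp
    then have "concentration \<rho> \<beta> * (?N * (?N - 1)\<^sup>2) < 1"
      using beta by (simp only: pos_less_divide_eq)
    then show ?thesis by (simp add: power2_eq_square ac_simps)
  qed
  define b where "b = ?N * (?N - 1) / 2 * \<phi> \<beta>"
  have phi_beta: "0 \<le> \<phi> \<beta>" using beta_pos by (rule phi_nonneg)
  have b: "0 \<le> b" using N2 phi_beta by (simp add: b_def)
  \<comment> \<open>As \<open>N \<ge> 2\<close>, the factor of \<open>\<phi> \<beta>\<close> is at
    least 1, so the argument of the inverse is at least \<open>\<phi> \<beta>\<close> and lies in
    the range of \<open>\<phi>\<close>.\<close>
  have "1 * 1 \<le> (?N\<^sup>2 / 2) * (?N - 1)"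
    using N2 power_mono[of 2 ?N 2] by (intro mult_mono) auto
  then have "\<phi> \<beta> \<le> ?N\<^sup>2 * (?N - 1) / 2 * \<phi> \<beta>"
    using phi_beta mult_right_mono[of 1 "?N\<^sup>2 * (?N - 1) / 2" "\<phi> \<beta>"] by simp
  then have "?N\<^sup>2 * (?N - 1) / 2 * \<phi> \<beta> < \<phi> \<alpha>"
    by (intro less_at_smaller_than_inverse[OF phi_cont phi_decr phi_lim beta_pos _ alpha_pos alpha])
  \<comment> \<open>There are \<open>N\<close> new points of cost at most \<open>b\<close> each,
    which is where the constant \<open>N^2 (N-1) / 2\<close> comes from.\<close>
  then have ab: "?N * b < \<phi> \<alpha>"
    by (simp add: b_def power2_eq_square mult.assoc)
  have far: "cost \<phi> x \<le> ennreal b" if "x \<notin> near_diagonal \<beta>"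
    for x :: "(real ^ 'd) ^ 'n::{finite,linorder}"
    unfolding b_def by (rule cost_le_off_diagonal[OF phi_decr beta_pos phi_beta that])
  note near = trunc_cost_ge_near_diagonal[OF phi_decr]
  have "emeasure P (near_diagonal \<alpha>) = 0"
    using P
  proof
    assume "is_minimizer (cost \<phi>) \<rho> P"
    from minimizer_null_near_diagonal[OF this measurable_cost[OF phi_cont] conc far _ b ab]
    show ?thesis by (metis near trunc_cost_le_cost order_trans)
  next
    assume "is_minimizer (trunc_cost \<phi> \<alpha>) \<rho> P"
    from minimizer_null_near_diagonal[OF this measurable_trunc_cost[OF phi_cont] conc _ near b ab]
    show ?thesis by (metis far trunc_cost_le_cost order_trans)
  qed
  \<comment> \<open>An open set of mass 0 contains no point of the support.\<close>
  then show ?thesis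
    using open_near_diagonal unfolding spt_def by fastforce
qed

end
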